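(* For every integer $n\geq 2$, the partial Latin square $P_n:=D_0\cup D_1\cup\dots\cup D_{\lceil (n-3)/2\rceil}$ is a minimally $2$-strong defining set of $B_n$.
   Context: $B_n=\{(i,j;i+j \bmod n): i,j\in\mathbb{Z}_n\}$ is the addition table of $\mathbb{Z}_n$, written as triples (row, column; symbol). For $i\in\mathbb{Z}_n$ the diagonal $D_i$ is $\{(r,r+i;2r+i \bmod n): r\in\mathbb{Z}_n\}\subseteq B_n$. A partial Latin square (PLS) is an array in which some cells may be empty and each symbol occurs at most once per row and column. A Latin trade in a Latin square $L$ is a non-empty PLS $T\subseteq L$ for which there is a PLS $T'$ of the same order with $T\cap T'=\emptyset$, the same set of non-empty cells as $T$, and the same set of symbols as $T$ in each row and in each column. A defining set of $L$ is a subset of $L$ contained in no other Latin square of the same order. A defining set $D$ of $L$ is $k$-strong if $|D\cap T|\geq k$ for every Latin trade $T\subseteq L$, and minimally $k$-strong if it is $k$-strong but no proper subset of it is. *)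

theory Defs
  imports Complex_Main
begin

text \<open>
  Arrays of order \<open>n\<close> are sets of triples (row, column, symbol). The residues modulo \<open>n\<close> are
  represented by the natural numbers below \<open>n\<close> and index rows, columns and symbols.
\<close>

type_synonym array = "(nat \<times> nat \<times> nat) set"

definition partial_latin_square :: "nat \<Rightarrow> array \<Rightarrow> bool" where
  "partial_latin_square n T \<longleftrightarrow>
     T \<subseteq> {..<n} \<times> {..<n} \<times> {..<n} \<and>
     (\<forall>r c s s'. (r, c, s) \<in> T \<and> (r, c, s') \<in> T \<longrightarrow> s = s') \<and>
     (\<forall>r c c' s. (r, c, s) \<in> T \<and> (r, c', s) \<in> T \<longrightarrow> c = c') \<and>
     (\<forall>r r' c s. (r, c, s) \<in> T \<and> (r', c, s) \<in> T \<longrightarrow> r = r')"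

definition latin_square :: "nat \<Rightarrow> array \<Rightarrow> bool" where
  "latin_square n L \<longleftrightarrow>
     L \<subseteq> {..<n} \<times> {..<n} \<times> {..<n} \<and>
     (\<forall>r<n. \<forall>c<n. \<exists>!s. (r, c, s) \<in> L) \<and>
     (\<forall>r<n. \<forall>s<n. \<exists>!c. (r, c, s) \<in> L) \<and>
     (\<forall>c<n. \<forall>s<n. \<exists>!r. (r, c, s) \<in> L)"

definition cells :: "array \<Rightarrow> (nat \<times> nat) set" where
  "cells T = {(r, c). \<exists>s. (r, c, s) \<in> T}"

definition row_symbols :: "array \<Rightarrow> nat \<Rightarrow> nat set" where
  "row_symbols T r = {s. \<exists>c. (r, c, s) \<in> T}"

definition column_symbols :: "array \<Rightarrow> nat \<Rightarrow> nat set" where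
  "column_symbols T c = {s. \<exists>r. (r, c, s) \<in> T}"

definition latin_trade :: "nat \<Rightarrow> array \<Rightarrow> array \<Rightarrow> bool" where
  "latin_trade n L T \<longleftrightarrow>
     T \<noteq> {} \<and> partial_latin_square n T \<and> T \<subseteq> L \<and>
     (\<exists>T'. partial_latin_square n T' \<and> T \<inter> T' = {} \<and> cells T' = cells T \<and>
        (\<forall>r<n. row_symbols T' r = row_symbols T r) \<and>
        (\<forall>c<n. column_symbols T' c = column_symbols T c))"

definition defining_set :: "nat \<Rightarrow> array \<Rightarrow> array \<Rightarrow> bool" where
  "defining_set n L D \<longleftrightarrow>
     latin_square n L \<and> D \<subseteq> L \<and> (\<forall>L'. latin_square n L' \<and> D \<subseteq> L' \<longrightarrow> L' = L)"

definition strong_defining_set :: "nat \<Rightarrow> nat \<Rightarrow> array \<Rightarrow> array \<Rightarrow> bool" where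
  "strong_defining_set k n L D \<longleftrightarrow>
     defining_set n L D \<and> (\<forall>T. latin_trade n L T \<longrightarrow> card (D \<inter> T) \<ge> k)"

definition minimally_strong_defining_set :: "nat \<Rightarrow> nat \<Rightarrow> array \<Rightarrow> array \<Rightarrow> bool" where
  "minimally_strong_defining_set k n L D \<longleftrightarrow>
     strong_defining_set k n L D \<and> (\<forall>D'. D' \<subset> D \<longrightarrow> \<not> strong_defining_set k n L D')"

definition addition_table :: "nat \<Rightarrow> array" where
  "addition_table n = {(i, j, (i + j) mod n) | i j. i < n \<and> j < n}"

definition diagonal :: "nat \<Rightarrow> nat \<Rightarrow> array" where
  "diagonal n i = {(r, (r + i) mod n, (2 * r + i) mod n) | r. r < n}"

text \<open>
  The last index \<open>\<lceil>(n - 3) / 2\<rceil>\<close> is computed in the reals, without truncated subtraction; it is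
  \<open>0\<close> for \<open>n = 2\<close>.
\<close>

definition diagonal_union :: "nat \<Rightarrow> array" where
  "diagonal_union n = (\<Union>i\<in>{i. int i \<le> \<lceil>(real n - 3) / 2\<rceil>}. diagonal n i)"

end

theory Submission
  imports Defs "HOL-Library.Multiset" "HOL-Number_Theory.Cong"
begin

text \<open>
  Let \<open>k = n div 2\<close> and call \<open>(c - r) mod n\<close> the offset of the cell \<open>(r, c)\<close>, so that the partial Latin
  square consists of the cells of offset below \<open>k\<close>. If the mate of a trade has an entry of offset
  \<open>d\<close>, its symbol occurs in the trade in the same row and in the same column, at offsets \<open>d'\<close> and
  \<open>d''\<close> with \<open>d' + d'' = 2 * d\<close> modulo \<open>n\<close>. All offsets in \<open>[k, n - 1]\<close> make this an equation of
  integers, which fails where \<open>d\<close> is maximal. If exactly one cell of the trade has a smaller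
  offset, the equation becomes \<open>d' + d'' = 2 * d + n\<close> there, and summing over the entries with the
  symbol that the mate has in this cell gives a contradiction.

  For minimality, a dissection of an \<open>a \<times> b\<close> rectangle with \<open>a + b = n\<close> into right isosceles lattice
  triangles yields a trade. The left and right corners of a \<open>k \<times> (n - k)\<close> rectangle can be placed
  on any given diagonal of the partial Latin square, and the dissection can be chosen with all other
  vertices of offset at least \<open>k\<close>.
\<close>

section \<open>Partial Latin squares\<close>

lemma partial_latin_square_unique:
  assumes "partial_latin_square n L"
  shows "(r, c, s) \<in> L \<Longrightarrow> (r, c, s') \<in> L \<Longrightarrow> s = s'"
    and "(r, c, s) \<in> L \<Longrightarrow> (r, c', s) \<in> L \<Longrightarrow> c = c'"
    and "(r, c, s) \<in> L \<Longrightarrow> (r', c, s) \<in> L \<Longrightarrow> r = r'"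
  using assms unfolding partial_latin_square_def by metis+

lemma partial_latin_squareI:
  assumes "L \<subseteq> {..<n} \<times> {..<n} \<times> {..<n}"
    and "\<And>r c s s'. (r, c, s) \<in> L \<Longrightarrow> (r, c, s') \<in> L \<Longrightarrow> s = s'"
    and "\<And>r c c' s. (r, c, s) \<in> L \<Longrightarrow> (r, c', s) \<in> L \<Longrightarrow> c = c'"
    and "\<And>r r' c s. (r, c, s) \<in> L \<Longrightarrow> (r', c, s) \<in> L \<Longrightarrow> r = r'"
  shows "partial_latin_square n L"
  unfolding partial_latin_square_def
  by (intro conjI allI impI; (elim conjE)?) (fact assms(1), erule (1) assms(2), erule (1) assms(3), erule (1) assms(4))

lemma latin_squareD:
  assumes "latin_square n L"
  shows "(r, c, s) \<in> L \<Longrightarrow> r < n \<and> c < n \<and> s < n"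
    and "r < n \<Longrightarrow> c < n \<Longrightarrow> \<exists>!s. (r, c, s) \<in> L"
    and "r < n \<Longrightarrow> s < n \<Longrightarrow> \<exists>!c. (r, c, s) \<in> L"
    and "c < n \<Longrightarrow> s < n \<Longrightarrow> \<exists>!r. (r, c, s) \<in> L"
proof -
  have "L \<subseteq> {..<n} \<times> {..<n} \<times> {..<n}"
    using assms by (simp add: latin_square_def)
  then show "(r, c, s) \<in> L \<Longrightarrow> r < n \<and> c < n \<and> s < n"
    by blast
qed (use assms in \<open>simp_all add: latin_square_def\<close>)

lemma latin_square_imp_partial:
  assumes L: "latin_square n L"
  shows "partial_latin_square n L"
proof (rule partial_latin_squareI)
  show "L \<subseteq> {..<n} \<times> {..<n} \<times> {..<n}"
    using L by (simp add: latin_square_def)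
  fix r r' c c' s s'
  assume x: "(r, c, s) \<in> L"
  show "s = s'" if "(r, c, s') \<in> L"
    using latin_squareD(2)[OF L, of r c] latin_squareD(1)[OF L x] x that by (metis (no_types))
  show "c = c'" if "(r, c', s) \<in> L"
    using latin_squareD(3)[OF L, of r s] latin_squareD(1)[OF L x] x that by (metis (no_types))
  show "r = r'" if "(r', c, s) \<in> L"
    using latin_squareD(4)[OF L, of c s] latin_squareD(1)[OF L x] x that by (metis (no_types))
qed

lemma partial_latin_square_subset:
  assumes L: "partial_latin_square n L" and sub: "T \<subseteq> L"
  shows "partial_latin_square n T"
proof (rule partial_latin_squareI)
  show "T \<subseteq> {..<n} \<times> {..<n} \<times> {..<n}"
    using L sub unfolding partial_latin_square_def by (elim conjE) (rule subset_trans)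
qed (use sub in \<open>auto dest: subsetD intro: partial_latin_square_unique[OF L]\<close>)

section \<open>The strip of the first diagonals\<close>

text \<open>Integer-valued, so that sums of offsets can be compared both modulo \<open>n\<close> and
  as plain integers.\<close>

definition offset :: "nat \<Rightarrow> nat \<Rightarrow> nat \<Rightarrow> int" where
  "offset n r c = (int c - int r) mod int n"

lemma offset_bounds: "n > 0 \<Longrightarrow> 0 \<le> offset n r c \<and> offset n r c < int n"
  by (simp add: offset_def)

text \<open>An integer \<open>i\<close> is at most the ceiling of \<open>x\<close> exactly when
  \<open>i - 1 < x\<close>. For \<open>x = (n - 3) / 2\<close> this reads
  \<open>2 * i + 1 < n\<close>, and for either parity of \<open>n\<close> that means
  \<open>i < n div 2\<close>.\<close>

lemma diagonal_index_eq: "{i. int i \<le> \<lceil>(real n - 3) / 2\<rceil>} = {..<n div 2}"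
proof (rule set_eqI)
  fix i :: nat
  have "int i \<le> \<lceil>(real n - 3) / 2\<rceil> \<longleftrightarrow> real i - 1 < (real n - 3) / 2"
    by (simp add: le_ceiling_iff)
  also have "\<dots> \<longleftrightarrow> real (2 * i + 1) < real n"
    by (simp add: field_simps)
  also have "\<dots> \<longleftrightarrow> 2 * i + 1 < n"
    by (rule of_nat_less_iff)
  also have "\<dots> \<longleftrightarrow> i < n div 2"
    by linarith
  finally show "i \<in> {i. int i \<le> \<lceil>(real n - 3) / 2\<rceil>} \<longleftrightarrow> i \<in> {..<n div 2}"
    by simp
qed

lemma mem_addition_table:
  "(r, c, s) \<in> addition_table n \<longleftrightarrow> r < n \<and> c < n \<and> s = (r + c) mod n"
  by (auto simp: addition_table_def)

lemma mem_diagonal_union: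
  assumes "n > 0"
  shows "(r, c, s) \<in> diagonal_union n \<longleftrightarrow>
    (r, c, s) \<in> addition_table n \<and> offset n r c < int (n div 2)"
proof
  assume "(r, c, s) \<in> diagonal_union n"
  then obtain i where i: "i < n div 2" "r < n" "c = (r + i) mod n" "s = (2 * r + i) mod n"
    by (auto simp: diagonal_union_def diagonal_index_eq diagonal_def)
  have "offset n r c = int i mod int n"
    unfolding offset_def i(3) zmod_int by (simp add: mod_diff_left_eq)
  also have "\<dots> = int i"
    using i(1) by simp
  finally have "offset n r c < int (n div 2)"
    using i(1) by simp
  moreover have "s = (r + c) mod n"
    unfolding i(3,4) by (simp add: mod_add_right_eq mult_2 add.assoc)
  ultimately show "(r, c, s) \<in> addition_table n \<and> offset n r c < int (n div 2)"
    using i assms by (simp add: mem_addition_table)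
next
  assume *: "(r, c, s) \<in> addition_table n \<and> offset n r c < int (n div 2)"
  define i where "i = nat (offset n r c)"
  have i: "int i = offset n r c"
    using offset_bounds[OF assms] by (simp add: i_def)
  have "int ((r + i) mod n) = int c mod int n"
    by (simp add: zmod_int i offset_def mod_add_right_eq)
  then have c: "c = (r + i) mod n"
    using * by (simp add: mem_addition_table)
  have s: "s = (2 * r + i) mod n"
    using * unfolding mem_addition_table c by (simp add: mod_add_right_eq mult_2 add.assoc)
  have "i < n div 2"
    using * i by simp
  then show "(r, c, s) \<in> diagonal_union n"
    using * c s by (auto simp: diagonal_union_def diagonal_index_eq diagonal_def mem_addition_table)
qed

lemma offset_inj:
  assumes "c < n" "c' < n" "offset n r c = offset n r c'"
  shows "c = c'"
proof -
  have "[int c - int r = int c' - int r] (mod int n)"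
    using assms(3) by (simp add: offset_def cong_def)
  then have "[int c = int c'] (mod int n)"
    by (simp add: cong_diff_iff_cong_0 cong_iff_dvd_diff)
  then show ?thesis
    using assms by (simp add: cong_def)
qed

section \<open>Trades meet the strip at least twice\<close>

text \<open>Equal symbols in \<open>(r, c')\<close> and \<open>(r', c)\<close> give
  \<open>c' - r' = c - r\<close> modulo \<open>n\<close>. It is used with \<open>s\<close> as the
  symbol of the mate in \<open>(r, c)\<close>.\<close>

lemma offset_matches_cong:
  assumes "(r, c', s) \<in> addition_table n" "(r', c, s) \<in> addition_table n"
  shows "[offset n r c' + offset n r' c = 2 * offset n r c] (mod int n)"
proof -
  have "[int r + int c' = int r' + int c] (mod int n)"
    using assms unfolding mem_addition_table cong_def
    by (metis of_nat_add of_nat_mod)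
  then have "int n dvd (int r + int c') - (int r' + int c)"
    by (simp add: cong_iff_dvd_diff)
  then have "[(int c' - int r) + (int c - int r') = 2 * (int c - int r)] (mod int n)"
    by (simp add: cong_iff_dvd_diff algebra_simps)
  then show ?thesis
    unfolding offset_def cong_def by (simp add: mod_simps)
qed

lemma cong_eq_of_small_diff:
  fixes x y m :: int
  assumes "[x = y] (mod m)" "\<bar>x - y\<bar> < m"
  shows "x = y"
  using assms by (metis cong_iff_dvd_diff dvd_imp_le_int abs_of_pos abs_ge_zero eq_iff_diff_eq_0 leD le_less_trans)

text \<open>
  The upper part \<open>[n div 2, n - 1]\<close> of the residues is short enough for congruences between
  \<open>d' + d''\<close> and \<open>2 * d\<close> to be equations of integers.
\<close>

lemma matches_upper:
  assumes "[d' + d'' = 2 * d] (mod int n)"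
    and "int (n div 2) \<le> d" "int (n div 2) \<le> d'" "int (n div 2) \<le> d''"
    and "d < int n" "d' < int n" "d'' < int n"
  shows "d' + d'' = 2 * d"
  \<comment> \<open>The two sides differ by at most \<open>2 * (n - 1 - n div 2)\<close>, which is
    at most \<open>n - 1\<close>.\<close>
  by (rule cong_eq_of_small_diff[OF assms(1)]) (use assms(2-) in linarith)

text \<open>Now \<open>d' + d'' - 2 * d\<close> lies between \<open>2\<close> and
  \<open>2 * n - 2\<close>, where \<open>n\<close> is the only multiple of \<open>n\<close>.\<close>

lemma matches_lower:
  assumes "[d' + d'' = 2 * d] (mod int n)"
    and "0 \<le> d" "d < int (n div 2)" "int (n div 2) \<le> d'" "int (n div 2) \<le> d''"
    and "d' < int n" "d'' < int n"
  shows "d' + d'' = 2 * d + int n"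
proof (rule cong_eq_of_small_diff)
  show "[d' + d'' = 2 * d + int n] (mod int n)"
    using assms(1) by (simp add: cong_def)
  show "\<bar>d' + d'' - (2 * d + int n)\<bar> < int n"
    using assms(2-) by linarith
qed

locale trade_with_mate =
  fixes n :: nat and T T' :: array
  assumes pos: "n > 0"
    and nonempty: "T \<noteq> {}"
    and sub: "T \<subseteq> addition_table n"
    and pls: "partial_latin_square n T" "partial_latin_square n T'"
    and disjoint: "T \<inter> T' = {}"
    and cells_eq: "cells T' = cells T"
    and rows_eq: "\<And>r. r < n \<Longrightarrow> row_symbols T' r = row_symbols T r"
    and cols_eq: "\<And>c. c < n \<Longrightarrow> column_symbols T' c = column_symbols T c"
begin

lemma mem_bounds': "(r, c, s) \<in> T' \<Longrightarrow> r < n \<and> c < n \<and> s < n"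
  using pls(2) unfolding partial_latin_square_def by (elim conjE) blast

lemma mem_bounds: "(r, c, s) \<in> T \<Longrightarrow> r < n \<and> c < n \<and> s < n"
  using pls(1) unfolding partial_latin_square_def by (elim conjE) blast

lemma row_match: "(r, c, s) \<in> T' \<Longrightarrow> \<exists>c'. (r, c', s) \<in> T"
  using rows_eq[of r] mem_bounds'[of r c s] by (auto simp: row_symbols_def)

lemma column_match: "(r, c, s) \<in> T' \<Longrightarrow> \<exists>r'. (r', c, s) \<in> T"
  using cols_eq[of c] mem_bounds'[of r c s] by (auto simp: column_symbols_def)

lemma row_match': "(r, c, s) \<in> T \<Longrightarrow> \<exists>c'. (r, c', s) \<in> T'"
  using rows_eq[of r] mem_bounds[of r c s] by (auto simp: row_symbols_def)

lemma column_match': "(r, c, s) \<in> T \<Longrightarrow> \<exists>r'. (r', c, s) \<in> T'"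
  using cols_eq[of c] mem_bounds[of r c s] by (auto simp: column_symbols_def)

lemma cell_match: "(r, c, s) \<in> T \<Longrightarrow> \<exists>s'. (r, c, s') \<in> T'"
  using cells_eq by (auto simp: cells_def set_eq_iff)

lemma cell_match': "(r, c, s) \<in> T' \<Longrightarrow> \<exists>s'. (r, c, s') \<in> T"
  using cells_eq by (auto simp: cells_def set_eq_iff)

lemma finite_T: "finite T"
proof (rule finite_subset)
  show "T \<subseteq> {..<n} \<times> {..<n} \<times> {..<n}"
    using mem_bounds by auto
qed simp

lemma upper:
  assumes "(r, c, s) \<in> T" "(r, c, s) \<notin> diagonal_union n"
  shows "int (n div 2) \<le> offset n r c"
  using assms sub by (auto simp: mem_diagonal_union[OF pos])

lemma meets: "diagonal_union n \<inter> T \<noteq> {}"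
proof
  assume empty: "diagonal_union n \<inter> T = {}"
  define f where "f = (\<lambda>(r, c, s :: nat). offset n r c)"
  have "Max (f ` T) \<in> f ` T"
    using finite_T nonempty by simp
  then obtain r c s where rcs: "(r, c, s) \<in> T" and max: "f (r, c, s) = Max (f ` T)"
    by (metis imageE prod_cases3)
  have le: "offset n r' c' \<le> offset n r c" if "(r', c', s') \<in> T" for r' c' s'
  proof -
    have "f (r', c', s') \<le> f (r, c, s)"
      unfolding max using finite_T that by simp
    then show ?thesis
      by (simp add: f_def)
  qed
  have up: "int (n div 2) \<le> offset n r' c'" if "(r', c', s') \<in> T" for r' c' s'
    using upper[OF that] empty that by auto
  obtain s' where s': "(r, c, s') \<in> T'"
    using cell_match rcs by blast
  obtain c' r' where c': "(r, c', s') \<in> T" and r': "(r', c, s') \<in> T"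
    using row_match column_match s' by blast
  have "offset n r c' + offset n r' c = 2 * offset n r c"
    using offset_matches_cong[of r c' s' n r' c] c' r' sub up[OF rcs] up[OF c'] up[OF r']
      offset_bounds[OF pos]
    by (intro matches_upper[of _ _ _ n]) auto
  \<comment> \<open>Neither summand exceeds the maximal offset, so both equal it. Then
    \<open>(r, c', s')\<close> occupies the cell \<open>(r, c)\<close>, and \<open>T\<close> shares
    an entry with its mate.\<close>
  then have "offset n r c' = offset n r c"
    using le[OF c'] le[OF r'] by simp
  then have "c' = c"
    using offset_inj mem_bounds c' rcs by blast
  then show False
    using c' s' disjoint by auto
qed

text \<open>
  The sum of the offsets of a symbol is computed in two ways: an entry of \<open>T\<close> is matched by one
  entry of \<open>T'\<close> in its row and by one in its column. The only entry in the strip would contribute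
  a single extra \<open>n\<close> to twice the difference, which is a multiple of \<open>n\<close>.
\<close>

lemma meets_not_once: "diagonal_union n \<inter> T \<noteq> {e}"
proof
  assume single: "diagonal_union n \<inter> T = {e}"
  obtain r0 c0 s0 where e: "e = (r0, c0, s0)"
    by (cases e)
  have e_T: "(r0, c0, s0) \<in> T" and e_P: "(r0, c0, s0) \<in> diagonal_union n"
    using single e by auto
  obtain s where s: "(r0, c0, s) \<in> T'"
    using cell_match e_T by blast
  have "s \<noteq> s0"
    using s e_T disjoint by auto
  \<comment> \<open>The cells of the symbol \<open>s\<close> in \<open>T\<close> and in the mate. As
    \<open>s \<noteq> s0\<close>, no cell of \<open>X\<close> lies in the strip, while
    \<open>(r0, c0)\<close> belongs to \<open>Y\<close>.\<close>
  define X where "X = {(r, c). (r, c, s) \<in> T}"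
  define Y where "Y = {(r, c). (r, c, s) \<in> T'}"
  \<comment> \<open>With the symbol fixed to \<open>s\<close>, the offset of an entry of
    \<open>T\<close> depends on its row alone or on its column alone. Since \<open>X\<close> and
    \<open>Y\<close> occupy the same rows and the same columns, once each, such sums carry over from
    \<open>X\<close> to \<open>Y\<close>.\<close>
  define \<phi> where "\<phi> = (\<lambda>r. (int s - 2 * int r) mod int n)"
  define \<psi> where "\<psi> = (\<lambda>c. (2 * int c - int s) mod int n)"
  define d where "d = (\<lambda>(r, c). offset n r c)"
  have X_sub: "X \<subseteq> {..<n} \<times> {..<n}" and Y_sub: "Y \<subseteq> {..<n} \<times> {..<n}"
    using mem_bounds mem_bounds' by (auto simp: X_def Y_def)
  have fin: "finite X" "finite Y"
    using X_sub Y_sub by (auto intro: finite_subset)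
  have inj: "inj_on fst X" "inj_on fst Y" "inj_on snd X" "inj_on snd Y"
    using partial_latin_square_unique(2,3)[OF pls(1)] partial_latin_square_unique(2,3)[OF pls(2)]
    unfolding inj_on_def X_def Y_def by auto
  have fst_eq: "fst ` X = fst ` Y"
    using row_match row_match' unfolding X_def Y_def by force
  have snd_eq: "snd ` X = snd ` Y"
    using column_match column_match' unfolding X_def Y_def by force
  have move_fst: "(\<Sum>x\<in>X. g (fst x)) = (\<Sum>y\<in>Y. g (fst y))" for g :: "nat \<Rightarrow> int"
    using sum.reindex[OF inj(1), of g] sum.reindex[OF inj(2), of g] fst_eq by simp
  have move_snd: "(\<Sum>x\<in>X. g (snd x)) = (\<Sum>y\<in>Y. g (snd y))" for g :: "nat \<Rightarrow> int"
    using sum.reindex[OF inj(3), of g] sum.reindex[OF inj(4), of g] snd_eq by simp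
  have d_X: "offset n r c = \<phi> r" "offset n r c = \<psi> c" if "(r, c, s) \<in> T" for r c
  proof -
    have "[int s = int r + int c] (mod int n)"
      using that sub by (auto simp: mem_addition_table cong_def zmod_int)
    then have dv: "int n dvd int s - (int r + int c)"
      by (simp add: cong_iff_dvd_diff)
    have "[int c - int r = int s - 2 * int r] (mod int n)"
      using dv by (simp add: cong_iff_dvd_diff algebra_simps dvd_diff_commute)
    moreover have "[int c - int r = 2 * int c - int s] (mod int n)"
      using dv by (simp add: cong_iff_dvd_diff algebra_simps)
    ultimately show "offset n r c = \<phi> r" "offset n r c = \<psi> c"
      by (simp_all add: offset_def \<phi>_def \<psi>_def cong_def)
  qed
  have up: "int (n div 2) \<le> offset n r c" if "(r, c, s') \<in> T" "(r, c, s') \<noteq> e" for r c s'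
    using upper[OF that(1)] single that by auto
  have step: "\<phi> r + \<psi> c = 2 * offset n r c + (if (r, c) = (r0, c0) then int n else 0)"
    if "(r, c) \<in> Y" for r c
  proof -
    have rc: "(r, c, s) \<in> T'"
      using that by (simp add: Y_def)
    obtain c' r' where c': "(r, c', s) \<in> T" and r': "(r', c, s) \<in> T"
      using row_match column_match rc by blast
    have cong: "[\<phi> r + \<psi> c = 2 * offset n r c] (mod int n)"
      using offset_matches_cong[of r c' s n r' c] c' r' sub d_X(1)[OF c'] d_X(2)[OF r'] by auto
    have b: "int (n div 2) \<le> \<phi> r" "\<phi> r < int n" "int (n div 2) \<le> \<psi> c" "\<psi> c < int n"
      using up[OF c'] up[OF r'] d_X(1)[OF c'] d_X(2)[OF r'] \<open>s \<noteq> s0\<close> e offset_bounds[OF pos]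
      by (metis prod.inject)+
    show ?thesis
    proof (cases "(r, c) = (r0, c0)")
      case True
      then have "offset n r c < int (n div 2)"
        using e_P by (simp add: mem_diagonal_union[OF pos])
      then show ?thesis
        using True matches_lower[OF cong _ _ b(1,3,2,4)] offset_bounds[OF pos] by simp
    next
      case False
      obtain s' where "(r, c, s') \<in> T"
        using cell_match' rc by blast
      then have "int (n div 2) \<le> offset n r c"
        using up False e by blast
      then show ?thesis
        using False matches_upper[OF cong _ b(1,3) _ b(2,4)] offset_bounds[OF pos] by auto
    qed
  qed
  have "2 * (\<Sum>x\<in>X. d x) = (\<Sum>x\<in>X. \<phi> (fst x)) + (\<Sum>x\<in>X. \<psi> (snd x))"
  proof -
    have "(\<Sum>x\<in>X. d x) = (\<Sum>x\<in>X. \<phi> (fst x))" "(\<Sum>x\<in>X. d x) = (\<Sum>x\<in>X. \<psi> (snd x))"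
      using d_X by (auto simp: X_def d_def intro!: sum.cong)
    then show ?thesis
      by simp
  qed
  also have "\<dots> = (\<Sum>y\<in>Y. \<phi> (fst y) + \<psi> (snd y))"
    by (simp add: move_fst move_snd sum.distrib)
  also have "\<dots> = (\<Sum>y\<in>Y. 2 * d y + (if y = (r0, c0) then int n else 0))"
    using step by (intro sum.cong) (auto simp: d_def split: if_splits)
  also have "\<dots> = 2 * (\<Sum>y\<in>Y. d y) + int n"
    using s fin(2) by (simp add: sum.distrib sum_distrib_left Y_def)
  finally have twice: "2 * ((\<Sum>x\<in>X. d x) - (\<Sum>y\<in>Y. d y)) = int n"
    by simp
  \<comment> \<open>Modulo \<open>n\<close> a sum of offsets is the sum of the columns minus that of
    the rows, which agrees for \<open>X\<close> and \<open>Y\<close>. So the difference is a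
    multiple of \<open>n\<close>, yet its double is \<open>n\<close>.\<close>
  have "[(\<Sum>z\<in>Z. d z) = (\<Sum>z\<in>Z. int (snd z)) - (\<Sum>z\<in>Z. int (fst z))] (mod int n)" for Z
    unfolding sum_subtractf[symmetric] by (rule cong_sum) (auto simp: d_def offset_def cong_def)
  from this[of X] this[of Y] have "[(\<Sum>x\<in>X. d x) = (\<Sum>y\<in>Y. d y)] (mod int n)"
    unfolding move_fst[of int] move_snd[of int] by (metis cong_sym cong_trans)
  then obtain t where "(\<Sum>x\<in>X. d x) - (\<Sum>y\<in>Y. d y) = int n * t"
    by (auto simp: cong_iff_dvd_diff)
  then have "int n * (2 * t - 1) = 0"
    using twice by (simp add: algebra_simps)
  then show False
    using pos by simp presburger
qed

lemma card_ge_two: "card (diagonal_union n \<inter> T) \<ge> 2"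
proof (rule ccontr)
  assume "\<not> ?thesis"
  then have "card (diagonal_union n \<inter> T) = 0 \<or> card (diagonal_union n \<inter> T) = 1"
    by linarith
  then show False
    using meets meets_not_once finite_T by (auto simp: card_1_singleton_iff)
qed

end

lemma trade_card_ge_two:
  assumes "n > 0" "latin_trade n (addition_table n) T"
  shows "card (diagonal_union n \<inter> T) \<ge> 2"
proof -
  obtain T' where "trade_with_mate n T T'"
    using assms unfolding latin_trade_def trade_with_mate_def by blast
  then show ?thesis
    by (rule trade_with_mate.card_ge_two)
qed

section \<open>Differences of Latin squares\<close>

text \<open>The mate is \<open>L' - L\<close>. Hence a second completion of a subset of
  \<open>L\<close> yields a trade that avoids this subset.\<close>

lemma latin_square_diff_trade:
  assumes L: "latin_square n L" and L': "latin_square n L'" and "L \<noteq> L'"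
  shows "latin_trade n L (L - L')"
proof -
  have cells: "cells (A - B) \<subseteq> cells (B - A)"
    and rows: "row_symbols (A - B) r \<subseteq> row_symbols (B - A) r"
    and cols: "column_symbols (A - B) c \<subseteq> column_symbols (B - A) c"
    if A: "latin_square n A" and B: "latin_square n B" for A B r c
  proof -
    have b: "r < n \<and> c < n \<and> s < n" if "(r, c, s) \<in> A" for r c s
      using latin_squareD(1)[OF A that] .
    note unique = partial_latin_square_unique[OF latin_square_imp_partial[OF A]]
    show "cells (A - B) \<subseteq> cells (B - A)"
    proof
      fix x assume "x \<in> cells (A - B)"
      then obtain r c s where x: "x = (r, c)" "(r, c, s) \<in> A" "(r, c, s) \<notin> B"
        by (auto simp: cells_def)
      obtain s' where s': "(r, c, s') \<in> B"
        using latin_squareD(2)[OF B] b[OF x(2)] by blast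
      have "(r, c, s') \<notin> A"
        using unique(1) x s' by blast
      then show "x \<in> cells (B - A)"
        using s' x(1) by (auto simp: cells_def)
    qed
    show "row_symbols (A - B) r \<subseteq> row_symbols (B - A) r"
    proof
      fix s assume "s \<in> row_symbols (A - B) r"
      then obtain c where x: "(r, c, s) \<in> A" "(r, c, s) \<notin> B"
        by (auto simp: row_symbols_def)
      obtain c' where c': "(r, c', s) \<in> B"
        using latin_squareD(3)[OF B] b[OF x(1)] by blast
      have "(r, c', s) \<notin> A"
        using unique(2) x c' by blast
      then show "s \<in> row_symbols (B - A) r"
        using c' by (auto simp: row_symbols_def)
    qed
    show "column_symbols (A - B) c \<subseteq> column_symbols (B - A) c"
    proof
      fix s assume "s \<in> column_symbols (A - B) c"
      then obtain r where x: "(r, c, s) \<in> A" "(r, c, s) \<notin> B"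
        by (auto simp: column_symbols_def)
      obtain r' where r': "(r', c, s) \<in> B"
        using latin_squareD(4)[OF B] b[OF x(1)] by blast
      have "(r', c, s) \<notin> A"
        using unique(3) x r' by blast
      then show "s \<in> column_symbols (B - A) c"
        using r' by (auto simp: column_symbols_def)
    qed
  qed
  have "L - L' \<noteq> {}"
  proof
    assume "L - L' = {}"
    have "cells (L' - L) = {}"
      using cells[OF L' L] unfolding \<open>L - L' = {}\<close> by (simp add: cells_def)
    then have "L' - L = {}"
      unfolding cells_def by auto
    then show False
      using \<open>L - L' = {}\<close> \<open>L \<noteq> L'\<close> by blast
  qed
  moreover have "partial_latin_square n (L - L')" "partial_latin_square n (L' - L)"
    using partial_latin_square_subset[OF latin_square_imp_partial] L L' by blast+
  moreover have "cells (L' - L) = cells (L - L')"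
    using cells[OF L L'] cells[OF L' L] by blast
  moreover have "row_symbols (L' - L) r = row_symbols (L - L') r" for r
    using rows[OF L L'] rows[OF L' L] by blast
  moreover have "column_symbols (L' - L) c = column_symbols (L - L') c" for c
    using cols[OF L L'] cols[OF L' L] by blast
  moreover have "L - L' \<subseteq> L" "(L - L') \<inter> (L' - L) = {}"
    by blast+
  ultimately show ?thesis
    unfolding latin_trade_def by (intro conjI exI[of _ "L' - L"]) simp_all
qed

lemma addition_unique:
  fixes n :: nat
  assumes "r < n" "s < n"
  shows "\<exists>!c. c < n \<and> s = (r + c) mod n"
proof (rule ex1I)
  have "(r + (s + (n - r))) mod n = s"
    using assms by simp
  then show "(s + (n - r)) mod n < n \<and> s = (r + (s + (n - r)) mod n) mod n"
    using assms by (simp add: mod_add_right_eq)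
  fix c assume c: "c < n \<and> s = (r + c) mod n"
  then have "(s + (n - r)) mod n = (r + c + (n - r)) mod n"
    by (simp add: mod_add_left_eq)
  also have "\<dots> = c"
    using c assms by simp
  finally show "c = (s + (n - r)) mod n" ..
qed

lemma latin_square_addition_table: "latin_square n (addition_table n)"
proof -
  have "\<exists>!c. (r, c, s) \<in> addition_table n" if "r < n" "s < n" for r s
    using addition_unique[OF that] that by (simp add: mem_addition_table)
  moreover have "\<exists>!r. (r, c, s) \<in> addition_table n" if "c < n" "s < n" for c s
    using addition_unique[OF that] that by (simp add: mem_addition_table add.commute conj_commute)
  moreover have "\<exists>!s. (r, c, s) \<in> addition_table n" if "r < n" "c < n" for r c
    using that by (simp add: mem_addition_table)
  moreover have "addition_table n \<subseteq> {..<n} \<times> {..<n} \<times> {..<n}"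
    by (auto simp: mem_addition_table)
  ultimately show ?thesis
    by (simp add: latin_square_def)
qed

section \<open>Triangulated rectangles\<close>

type_synonym cell = "int \<times> int"

text \<open>Positions refer to a picture with \<open>x + y\<close> pointing up and
  \<open>y - x\<close> pointing right: bottom and top are the corners with extreme symbol, left and
  right those with extreme offset.\<close>

definition bottom_top :: "int \<Rightarrow> int \<Rightarrow> int \<Rightarrow> int \<Rightarrow> cell multiset" where
  "bottom_top r c a b = {#(r, c), (r + a, c + b)#}"

definition left_right :: "int \<Rightarrow> int \<Rightarrow> int \<Rightarrow> int \<Rightarrow> cell multiset" where
  "left_right r c a b = {#(r + a, c), (r, c + b)#}"

text \<open>
  An element \<open>(x, y, d)\<close> of \<open>Q\<close> puts the symbol \<open>x + y + d\<close> into the cell \<open>(x, y)\<close> of the addition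
  table of the integers. This symbol originally sits in column \<open>y + d\<close> of its row and in row
  \<open>x + d\<close> of its column, so \<open>Q\<close> is a dissection of a rectangle into right triangles
  \<open>(x, y), (x, y + d), (x + d, y)\<close>.
\<close>

definition triangulation ::
    "int \<Rightarrow> int \<Rightarrow> int \<Rightarrow> int \<Rightarrow> cell set \<Rightarrow> (int \<times> int \<times> int) multiset \<Rightarrow> bool" where
  "triangulation r c a b M Q \<longleftrightarrow>
     finite M \<and> M \<subseteq> {r..r + a} \<times> {c..c + b} \<and> (\<forall>(x, y, d) \<in># Q. d \<noteq> 0) \<and>
     image_mset (\<lambda>(x, y, d). (x, y)) Q + left_right r c a b = mset_set M \<and>
     image_mset (\<lambda>(x, y, d). (x, y + d)) Q + bottom_top r c a b = mset_set M \<and>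
     image_mset (\<lambda>(x, y, d). (x + d, y)) Q + bottom_top r c a b = mset_set M"

lemma triangulation_square:
  assumes "a > 0"
  shows "triangulation r c a a {(r, c), (r, c + a), (r + a, c), (r + a, c + a)}
    {#(r, c, a), (r + a, c + a, - a)#}"
  using assms by (auto simp: triangulation_def bottom_top_def left_right_def)

lemma triangulation_empty:
  assumes "a = 0 \<and> b > 0 \<or> a > 0 \<and> b = 0"
  shows "triangulation r c a b {(r, c), (r + a, c + b)} {#}"
  using assms by (auto simp: triangulation_def bottom_top_def left_right_def)

text \<open>The new square meets the old rectangle in the side from \<open>(r + b, c)\<close> to
  \<open>(r + b, c + b)\<close>. These are the old bottom and right corners; they stop being
  corners, and the two triangles of the square account for them instead.\<close>

lemma triangulation_extend_rows:
  assumes "triangulation (r + b) c a b M Q" "a \<ge> 0" "b > 0"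
  shows "triangulation r c (a + b) b ({(r, c), (r, c + b)} \<union> M)
    (Q + {#(r, c, b), (r + b, c + b, - b)#})"
proof -
  have fin: "finite M" and sub: "M \<subseteq> {r + b..r + b + a} \<times> {c..c + b}"
    using assms(1) by (auto simp: triangulation_def)
  have new: "(r, y) \<notin> M" for y
    using sub assms(3) by auto
  have "mset_set ({(r, c), (r, c + b)} \<union> M) = {#(r, c), (r, c + b)#} + mset_set M"
    using fin new assms(3) by simp
  then show ?thesis
    using assms sub unfolding triangulation_def bottom_top_def left_right_def
    by (auto simp: algebra_simps add_mset_commute)
qed

lemma triangulation_extend_columns:
  assumes "triangulation r (c + a) a b M Q" "a > 0" "b \<ge> 0"
  shows "triangulation r c a (a + b) ({(r, c), (r + a, c)} \<union> M)
    (Q + {#(r, c, a), (r + a, c + a, - a)#})"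
proof -
  have fin: "finite M" and sub: "M \<subseteq> {r..r + a} \<times> {c + a..c + a + b}"
    using assms(1) by (auto simp: triangulation_def)
  have new: "(x, c) \<notin> M" for x
    using sub assms(2) by auto
  have "mset_set ({(r, c), (r + a, c)} \<union> M) = {#(r, c), (r + a, c)#} + mset_set M"
    using fin new assms(2) by simp
  then show ?thesis
    using assms sub unfolding triangulation_def bottom_top_def left_right_def
    by (auto simp: algebra_simps add_mset_commute)
qed

text \<open>As in the Euclidean algorithm, squares are cut off until one side vanishes.\<close>

lemma triangulation_exists:
  assumes "a \<ge> 0" "b \<ge> 0" "a + b > 0"
  shows "\<exists>M Q. triangulation r c a b M Q"
  using assms
proof (induction "nat (a + b)" arbitrary: a b r c rule: less_induct)
  case less
  consider "a = 0 \<or> b = 0" | "0 < b" "b \<le> a" | "0 < a" "a < b"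
    using less.prems by linarith
  then show ?case
  proof cases
    case 1
    then show ?thesis
      using triangulation_empty[of a b r c] less.prems by (metis add_0 add_0_right)
  next
    case 2
    then have "\<exists>M Q. triangulation (r + b) c (a - b) b M Q"
      by (intro less.hyps) auto
    then obtain M Q where "triangulation (r + b) c (a - b) b M Q"
      by blast
    then show ?thesis
      using triangulation_extend_rows[of r b c "a - b" M Q] 2 by auto
  next
    case 3
    then have "\<exists>M Q. triangulation r (c + a) a (b - a) M Q"
      by (intro less.hyps) auto
    then obtain M Q where "triangulation r (c + a) a (b - a) M Q"
      by blast
    then show ?thesis
      using triangulation_extend_columns[of r c a "b - a" M Q] 3 by auto
  qed
qed

text \<open>
  Four triangles at the left and right corners of a \<open>(p + q + 1) \<times> (p + q + 2)\<close> rectangle leave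
  two rectangles, which lie in a narrow strip around the diagonal from bottom to top.
\<close>

lemma triangulation_strip:
  assumes "p \<ge> 0" "q \<ge> 0"
  shows "\<exists>M Q. triangulation r c (p + q + 1) (p + q + 2) M Q \<and>
    (\<forall>(x, y) \<in> M. (x, y) = (r, c + p + q + 2) \<or> (x, y) = (r + p + q + 1, c) \<or>
       c - r - p \<le> y - x \<and> y - x \<le> c - r + q + 1)"
proof -
  \<comment> \<open>The two rectangles left over, the first at the bottom corner and the second at
    the top corner.\<close>
  obtain M1 Q1 where 1: "triangulation r c p (q + 1) M1 Q1"
    using triangulation_exists[of p "q + 1" r c] assms by auto
  obtain M2 Q2 where 2: "triangulation (r + p + 1) (c + q + 1) q (p + 1) M2 Q2"
    using triangulation_exists[of q "p + 1" "r + p + 1" "c + q + 1"] assms by auto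
  define E where "E = {(r, c + p + q + 2), (r + p + q + 1, c)}"
  define M where "M = E \<union> (M1 \<union> M2)"
  \<comment> \<open>The first two added triangles form a square of side \<open>q + 1\<close> at the
    left corner, the last two a square of side \<open>p + 1\<close> at the right corner.\<close>
  define Q where "Q = Q1 + Q2 + {#(r + p, c, q + 1), (r + p + q + 1, c + q + 1, - (q + 1)),
    (r, c + q + 1, p + 1), (r + p + 1, c + p + q + 2, - (p + 1))#}"
  have fin: "finite M1" "finite M2"
    using 1 2 by (simp_all add: triangulation_def)
  have sub1: "M1 \<subseteq> {r..r + p} \<times> {c..c + (q + 1)}"
    using 1 by (simp add: triangulation_def)
  have sub2: "M2 \<subseteq> {r + p + 1..r + p + 1 + q} \<times> {c + q + 1..c + q + 1 + (p + 1)}"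
    using 2 by (simp add: triangulation_def)
  have "{r..r + p} \<inter> {r + p + 1..r + p + 1 + q} = {}"
    by auto
  then have "M1 \<inter> M2 = {}"
    using sub1 sub2 by blast
  moreover have "E \<inter> M1 = {}" "E \<inter> M2 = {}"
    using sub1 sub2 assms unfolding E_def by auto
  ultimately have "mset_set M = mset_set E + (mset_set M1 + mset_set M2)"
    unfolding M_def using fin by (simp add: mset_set_Union Int_Un_distrib E_def)
  then have mset: "mset_set M =
      {#(r, c + p + q + 2), (r + p + q + 1, c)#} + (mset_set M1 + mset_set M2)"
    using assms by (simp add: E_def)
  \<comment> \<open>The right angles of the four triangles are the left and right corners of the two
    rectangles.\<close>
  have "image_mset (\<lambda>(x, y, d). (x, y)) Q + left_right r c (p + q + 1) (p + q + 2) = mset_set M"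
  proof -
    have "image_mset (\<lambda>(x, y, d). (x, y)) Q1 + {#(r + p, c), (r, c + q + 1)#} = mset_set M1"
      "image_mset (\<lambda>(x, y, d). (x, y)) Q2 +
        {#(r + p + q + 1, c + q + 1), (r + p + 1, c + p + q + 2)#} = mset_set M2"
      using 1 2 by (simp_all add: triangulation_def left_right_def algebra_simps)
    then show ?thesis
      unfolding mset by (simp add: Q_def left_right_def algebra_simps flip: \<open>_ = mset_set M1\<close> \<open>_ = mset_set M2\<close>)
  qed
  \<comment> \<open>The acute vertices supply \<open>E\<close>, the top of the first rectangle and
    the bottom of the second.\<close>
  moreover have
    "image_mset (\<lambda>(x, y, d). (x, y + d)) Q + bottom_top r c (p + q + 1) (p + q + 2) = mset_set M"
  proof -
    have "image_mset (\<lambda>(x, y, d). (x, y + d)) Q1 + {#(r, c), (r + p, c + q + 1)#} = mset_set M1"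
      "image_mset (\<lambda>(x, y, d). (x, y + d)) Q2 +
        {#(r + p + 1, c + q + 1), (r + p + q + 1, c + p + q + 2)#} = mset_set M2"
      using 1 2 by (simp_all add: triangulation_def bottom_top_def algebra_simps)
    then show ?thesis
      unfolding mset by (simp add: Q_def bottom_top_def algebra_simps flip: \<open>_ = mset_set M1\<close> \<open>_ = mset_set M2\<close>)
  qed
  moreover have
    "image_mset (\<lambda>(x, y, d). (x + d, y)) Q + bottom_top r c (p + q + 1) (p + q + 2) = mset_set M"
  proof -
    have "image_mset (\<lambda>(x, y, d). (x + d, y)) Q1 + {#(r, c), (r + p, c + q + 1)#} = mset_set M1"
      "image_mset (\<lambda>(x, y, d). (x + d, y)) Q2 +
        {#(r + p + 1, c + q + 1), (r + p + q + 1, c + p + q + 2)#} = mset_set M2"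
      using 1 2 by (simp_all add: triangulation_def bottom_top_def algebra_simps)
    then show ?thesis
      unfolding mset by (simp add: Q_def bottom_top_def algebra_simps flip: \<open>_ = mset_set M1\<close> \<open>_ = mset_set M2\<close>)
  qed
  moreover have "M \<subseteq> {r..r + (p + q + 1)} \<times> {c..c + (p + q + 2)}"
    using sub1 sub2 assms unfolding M_def E_def by auto
  moreover have "\<forall>(x, y, d) \<in># Q. d \<noteq> 0"
    using 1 2 assms by (auto simp: Q_def triangulation_def)
  ultimately have "triangulation r c (p + q + 1) (p + q + 2) M Q"
    using fin by (simp add: triangulation_def M_def E_def)
  moreover have "\<forall>(x, y) \<in> M. (x, y) = (r, c + p + q + 2) \<or> (x, y) = (r + p + q + 1, c) \<or>
      c - r - p \<le> y - x \<and> y - x \<le> c - r + q + 1"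
    using sub1 sub2 unfolding M_def E_def by auto
  ultimately show ?thesis
    by blast
qed

section \<open>From triangulated rectangles to trades\<close>

text \<open>\<open>M\<close> has as many elements as \<open>X\<close> counted with multiplicity, and
  \<open>f\<close> maps the support of \<open>X\<close> onto \<open>M\<close>; so no element is lost
  and \<open>f\<close> is injective on the support.\<close>

lemma image_mset_eq_mset_set:
  assumes "image_mset f X = mset_set M" "finite M"
  shows "bij_betw f (set_mset X) M"
proof -
  have im: "f ` set_mset X = M"
    using assms by (metis finite_set_mset_mset_set set_image_mset)
  have "card M = size X"
    using assms by (metis size_image_mset size_mset_set)
  moreover have "card (set_mset X) \<le> size X"
    by (metis card_mono finite_set_mset size_multiset_overloaded_eq order_refl
        sum_mono card_eq_sum count_greater_eq_one_iff)
  moreover have "card M \<le> card (set_mset X)"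
    using im card_image_le by blast
  ultimately have "card (f ` set_mset X) = card (set_mset X)"
    using im by simp
  then show ?thesis
    using im by (simp add: bij_betw_def inj_on_iff_eq_card)
qed

definition residue_triple :: "nat \<Rightarrow> int \<Rightarrow> int \<Rightarrow> int \<Rightarrow> nat \<times> nat \<times> nat" where
  "residue_triple n x y z = (nat (x mod int n), nat (y mod int n), nat (z mod int n))"

lemma residue_eq_iff:
  assumes "n > 0"
  shows "nat (x mod int n) = nat (y mod int n) \<longleftrightarrow> [x = y] (mod int n)"
  using assms by (simp add: cong_def eq_nat_nat_iff)

lemma cong_window:
  fixes x y z m :: int
  assumes "[x = y] (mod m)" "x \<in> {z..z + a}" "y \<in> {z..z + a}" "a < m"
  shows "x = y"
  by (rule cong_eq_of_small_diff[OF assms(1)]) (use assms(2-) in auto)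

text \<open>
  The bottom and top corners of a rectangle of half perimeter \<open>n\<close> carry the same symbol modulo
  \<open>n\<close>, which completes the left and right corners. Over the integers, the rows ask for a
  different choice of this symbol than the columns, whence \<open>QR\<close> and \<open>QC\<close>.
\<close>

lemma triangulation_trade:
  assumes tri: "triangulation r c a b M Q" and ab: "a > 0" "b > 0" "a + b = int n"
  shows "latin_trade n (addition_table n) ((\<lambda>(x, y). residue_triple n x y (x + y)) ` M)"
proof -
  have n: "n > 0"
    using ab by simp
  \<comment> \<open>In \<open>QR\<close> the right corner receives the symbol of the bottom corner
    and the left corner that of the top; in \<open>QC\<close> it is the reverse. The two symbols
    differ by \<open>a + b = n\<close>, so both describe the same array modulo
    \<open>n\<close>.\<close>
  define QR where "QR = set_mset (Q + {#(r, c + b, - b), (r + a, c, b)#})"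
  define QC where "QC = set_mset (Q + {#(r, c + b, a), (r + a, c, - a)#})"
  define T where "T = (\<lambda>(x, y). residue_triple n x y (x + y)) ` M"
  define T' where "T' = (\<lambda>(x, y, d). residue_triple n x y (x + y + d)) ` QR"
  have fin: "finite M" and box: "M \<subseteq> {r..r + a} \<times> {c..c + b}"
    using tri by (simp_all add: triangulation_def)
  have cell: "bij_betw (\<lambda>(x, y, d). (x, y)) QR M"
    unfolding QR_def by (rule image_mset_eq_mset_set[OF _ fin])
      (use tri in \<open>simp add: triangulation_def left_right_def add_mset_commute\<close>)
  have row: "bij_betw (\<lambda>(x, y, d). (x, y + d)) QR M"
    unfolding QR_def by (rule image_mset_eq_mset_set[OF _ fin])
      (use tri in \<open>simp add: triangulation_def bottom_top_def add_mset_commute\<close>)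
  have col: "bij_betw (\<lambda>(x, y, d). (x + d, y)) QC M"
    unfolding QC_def by (rule image_mset_eq_mset_set[OF _ fin])
      (use tri in \<open>simp add: triangulation_def bottom_top_def add_mset_commute\<close>)
  have T'_QC: "T' = (\<lambda>(x, y, d). residue_triple n x y (x + y + d)) ` QC"
  proof -
    have "int n dvd - a - b" "int n dvd a + b"
      by (rule dvdI[of _ _ "- 1"], simp flip: ab(3)) (simp add: ab(3))
    then have "residue_triple n r (c + b) (r + (c + b) + - b) = residue_triple n r (c + b) (r + (c + b) + a)"
      "residue_triple n (r + a) c (r + a + c + b) = residue_triple n (r + a) c (r + a + c + - a)"
      unfolding residue_triple_def prod.inject residue_eq_iff[OF n]
      by (simp_all add: cong_iff_dvd_diff minus_diff_commute)
    then show ?thesis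
      unfolding T'_def QR_def QC_def by (simp add: algebra_simps)
  qed
  \<comment> \<open>Since \<open>a\<close> and \<open>b\<close> are below \<open>n\<close>, residues
    determine the rows and columns of \<open>M\<close>. Symbols span a range of length
    \<open>n\<close>, so a congruence of symbols is first turned into one of rows or
    columns.\<close>
  have eq_row: "x = x'" if "(x, y) \<in> M" "(x', y') \<in> M" "[x = x'] (mod int n)" for x y x' y'
    by (rule cong_window[OF that(3), of r a]) (use box that ab in auto)
  have eq_col: "y = y'" if "(x, y) \<in> M" "(x', y') \<in> M" "[y = y'] (mod int n)" for x y x' y'
    by (rule cong_window[OF that(3), of c b]) (use box that ab in auto)
  have QR_cell: "(x, y) \<in> M" and QR_row: "(x, y + d) \<in> M" if "(x, y, d) \<in> QR" for x y d
    using bij_betw_apply[OF cell that] bij_betw_apply[OF row that] by simp_all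
  have QC_cell: "(x, y) \<in> M" and QC_col: "(x + d, y) \<in> M" if "(x, y, d) \<in> QC" for x y d
  proof -
    show "(x + d, y) \<in> M"
      using bij_betw_apply[OF col that] by simp
    have "\<exists>d'. (x, y, d') \<in> QR"
      using that by (auto simp: QC_def QR_def)
    then show "(x, y) \<in> M"
      using QR_cell by blast
  qed
  have nz: "d \<noteq> 0" if "(x, y, d) \<in> QR" for x y d
    using that tri ab by (auto simp: QR_def triangulation_def)
  have in_range: "residue_triple n x y z \<in> {..<n} \<times> {..<n} \<times> {..<n}" for x y z
    using n by (simp add: residue_triple_def nat_less_iff)
  have T_mem: "\<exists>x y. (x, y) \<in> M \<and> (i, j, k) = residue_triple n x y (x + y)"
    if "(i, j, k) \<in> T" for i j k
    using that by (auto simp: T_def)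
  have T'_mem_row: "\<exists>x y d. (x, y, d) \<in> QR \<and> (i, j, k) = residue_triple n x y (x + y + d)"
    if "(i, j, k) \<in> T'" for i j k
    using that by (auto simp: T'_def)
  have T'_mem_col: "\<exists>x y d. (x, y, d) \<in> QC \<and> (i, j, k) = residue_triple n x y (x + y + d)"
    if "(i, j, k) \<in> T'" for i j k
    using that by (auto simp: T'_QC)
  have T_intro: "residue_triple n x y (x + y) \<in> T" if "(x, y) \<in> M" for x y
    using that by (force simp: T_def)
  have T'_intro_row: "residue_triple n x y (x + y + d) \<in> T'" if "(x, y, d) \<in> QR" for x y d
    using that by (force simp: T'_def)
  have T'_intro_col: "residue_triple n x y (x + y + d) \<in> T'" if "(x, y, d) \<in> QC" for x y d
    using that by (force simp: T'_QC)
  have T_sub: "T \<subseteq> addition_table n"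
  proof -
    have "residue_triple n x y (x + y) \<in> addition_table n" for x y
    proof -
      have "int ((nat (x mod int n) + nat (y mod int n)) mod n) = (x + y) mod int n"
        using n by (simp add: zmod_int mod_add_eq)
      then have "nat ((x + y) mod int n) = (nat (x mod int n) + nat (y mod int n)) mod n"
        by (metis nat_int)
      then show ?thesis
        using n by (simp add: residue_triple_def mem_addition_table nat_less_iff)
    qed
    then show ?thesis
      by (auto simp: T_def)
  qed
  have disj: "T \<inter> T' = {}"
  proof (rule ccontr)
    assume "T \<inter> T' \<noteq> {}"
    then obtain i j k where "(i, j, k) \<in> T" "(i, j, k) \<in> T'"
      by (metis disjoint_iff prod_cases3)
    then obtain x y x' y' d where *: "(x, y) \<in> M" "(x', y', d) \<in> QR"
      "residue_triple n x y (x + y) = residue_triple n x' y' (x' + y' + d)"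
      using T_mem T'_mem_row by metis
    have "[x = x'] (mod int n)" "[y = y'] (mod int n)" "[x + y = x' + y' + d] (mod int n)"
      using *(3) by (simp_all add: residue_triple_def residue_eq_iff[OF n])
    moreover from this have "x = x'" "y = y'"
      using eq_row eq_col *(1) QR_cell[OF *(2)] by blast+
    ultimately have "[y = y' + d] (mod int n)"
      by (simp add: cong_iff_dvd_diff)
    then have "y = y' + d"
      using eq_col *(1) QR_row[OF *(2)] by blast
    then show False
      using \<open>y = y'\<close> nz[OF *(2)] by simp
  qed
  have pls': "partial_latin_square n T'"
  proof (rule partial_latin_squareI)
    show "T' \<subseteq> {..<n} \<times> {..<n} \<times> {..<n}"
      unfolding T'_def by (rule image_subsetI) (use in_range in \<open>simp split: prod.split\<close>)
    show "k = k'" if ij: "(i, j, k) \<in> T'" "(i, j, k') \<in> T'" for i j k k'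
    proof -
      obtain x y d x' y' d' where *: "(x, y, d) \<in> QR" "(x', y', d') \<in> QR"
        "(i, j, k) = residue_triple n x y (x + y + d)"
        "(i, j, k') = residue_triple n x' y' (x' + y' + d')"
        using T'_mem_row[OF ij(1)] T'_mem_row[OF ij(2)] by blast
      have "[x = x'] (mod int n)" "[y = y'] (mod int n)"
        using *(3,4) by (simp_all add: residue_triple_def flip: residue_eq_iff[OF n])
      then have "x = x'" "y = y'"
        using eq_row eq_col QR_cell *(1,2) by blast+
      then have "d = d'"
        using inj_onD[OF bij_betw_imp_inj_on[OF cell] _ *(1,2)] by simp
      then show ?thesis
        using *(3,4) \<open>x = x'\<close> \<open>y = y'\<close> by (simp add: residue_triple_def)
    qed
    show "j = j'" if ij: "(i, j, k) \<in> T'" "(i, j', k) \<in> T'" for i j j' k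
    proof -
      obtain x y d x' y' d' where *: "(x, y, d) \<in> QR" "(x', y', d') \<in> QR"
        "(i, j, k) = residue_triple n x y (x + y + d)"
        "(i, j', k) = residue_triple n x' y' (x' + y' + d')"
        using T'_mem_row[OF ij(1)] T'_mem_row[OF ij(2)] by blast
      have "[x = x'] (mod int n)" "[x + y + d = x' + y' + d'] (mod int n)"
        using *(3,4) by (simp_all add: residue_triple_def flip: residue_eq_iff[OF n])
      moreover from this have x: "x = x'"
        using eq_row QR_cell *(1,2) by blast
      ultimately have "[y + d = y' + d'] (mod int n)"
        by (simp add: cong_iff_dvd_diff algebra_simps)
      then have "y + d = y' + d'"
        using eq_col QR_row *(1,2) by blast
      then have "y = y'"
        using inj_onD[OF bij_betw_imp_inj_on[OF row] _ *(1,2)] x by simp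
      then show ?thesis
        using *(3,4) by (simp add: residue_triple_def)
    qed
    show "i = i'" if ij: "(i, j, k) \<in> T'" "(i', j, k) \<in> T'" for i i' j k
    proof -
      obtain x y d x' y' d' where *: "(x, y, d) \<in> QC" "(x', y', d') \<in> QC"
        "(i, j, k) = residue_triple n x y (x + y + d)"
        "(i', j, k) = residue_triple n x' y' (x' + y' + d')"
        using T'_mem_col[OF ij(1)] T'_mem_col[OF ij(2)] by blast
      have "[y = y'] (mod int n)" "[x + y + d = x' + y' + d'] (mod int n)"
        using *(3,4) by (simp_all add: residue_triple_def flip: residue_eq_iff[OF n])
      moreover from this have y: "y = y'"
        using eq_col QC_cell *(1,2) by blast
      ultimately have "[x + d = x' + d'] (mod int n)"
        by (simp add: cong_iff_dvd_diff algebra_simps)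
      then have "x + d = x' + d'"
        using eq_row QC_col *(1,2) by blast
      then have "x = x'"
        using inj_onD[OF bij_betw_imp_inj_on[OF col] _ *(1,2)] y by simp
      then show ?thesis
        using *(3,4) by (simp add: residue_triple_def)
    qed
  qed
  have "cells T' = cells T"
  proof -
    have "cells T = (\<lambda>(x, y). (nat (x mod int n), nat (y mod int n))) ` M"
      by (force simp: cells_def T_def residue_triple_def)
    also have "\<dots> = (\<lambda>(x, y). (nat (x mod int n), nat (y mod int n))) ` (\<lambda>(x, y, d). (x, y)) ` QR"
      using cell by (simp add: bij_betw_def)
    also have "\<dots> = cells T'"
      by (force simp: cells_def T'_def residue_triple_def)
    finally show ?thesis ..
  qed
  moreover have "row_symbols T' i = row_symbols T i" for i
  proof -
    \<comment> \<open>Pairs of row and symbol are images of the cells of \<open>M\<close>, which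
      \<open>row\<close> parametrises by \<open>QR\<close>: the cell \<open>(x, y + d)\<close> has
      row \<open>x\<close> and symbol \<open>x + y + d\<close>.\<close>
    have "{(i, k). k \<in> row_symbols T i} = (\<lambda>(x, y). (nat (x mod int n), nat ((x + y) mod int n))) ` M"
      by (force simp: row_symbols_def T_def residue_triple_def)
    also have "\<dots> = (\<lambda>(x, y). (nat (x mod int n), nat ((x + y) mod int n))) `
        (\<lambda>(x, y, d). (x, y + d)) ` QR"
      using row by (simp add: bij_betw_def)
    also have "\<dots> = {(i, k). k \<in> row_symbols T' i}"
      by (force simp: row_symbols_def T'_def residue_triple_def add.assoc)
    finally show ?thesis
      by blast
  qed
  moreover have "column_symbols T' j = column_symbols T j" for j
  proof -
    have "{(j, k). k \<in> column_symbols T j} = (\<lambda>(x, y). (nat (y mod int n), nat ((x + y) mod int n))) ` M"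
      by (force simp: column_symbols_def T_def residue_triple_def)
    also have "\<dots> = (\<lambda>(x, y). (nat (y mod int n), nat ((x + y) mod int n))) `
        (\<lambda>(x, y, d). (x + d, y)) ` QC"
      using col by (simp add: bij_betw_def)
    also have "\<dots> = {(j, k). k \<in> column_symbols T' j}"
      by (force simp: column_symbols_def T'_QC residue_triple_def algebra_simps)
    finally show ?thesis
      by blast
  qed
  moreover have "M \<noteq> {}"
    using row by (auto simp: QR_def bij_betw_def)
  then have "T \<noteq> {}"
    by (simp add: T_def)
  moreover have "partial_latin_square n T"
    using latin_square_imp_partial[OF latin_square_addition_table] T_sub
    by (rule partial_latin_square_subset)
  ultimately show ?thesis
    unfolding T_def[symmetric] latin_trade_def using T_sub disj pls' by blast
qed

section \<open>Minimality\<close>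

text \<open>Without the given entry, the strip would meet this trade in at most the single entry
  \<open>f\<close>.\<close>

lemma trade_through_entry:
  assumes n: "n \<ge> 2" and e: "(r, c, s) \<in> diagonal_union n"
  shows "\<exists>T f. latin_trade n (addition_table n) T \<and> diagonal_union n \<inter> T \<subseteq> {(r, c, s), f}"
proof -
  define k where "k = int (n div 2)"
  define i where "i = offset n r c"
  have pos: "n > 0"
    using n by simp
  have e': "r < n" "c < n" "s = (r + c) mod n"
    using e by (simp_all add: mem_diagonal_union[OF pos] mem_addition_table)
  have i: "0 \<le> i" "i < k"
    using e offset_bounds[OF pos, of r c] by (simp_all add: mem_diagonal_union[OF pos] i_def k_def)
  define h where "h = int n - k"
  have h: "h = k \<or> h = k + 1" "0 < h" "0 < k" "k + h = int n"
    using n by (auto simp: h_def k_def)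
  \<comment> \<open>This choice puts the right corner \<open>(R, C + h)\<close> on the cell
    \<open>(r, c)\<close> modulo \<open>n\<close>; the left corner \<open>(R + k, C)\<close> lands
    on the same diagonal \<open>i\<close>.\<close>
  define R C where "R = int r" and "C = int r + i + k"
  obtain M Q where tri: "triangulation R C k h M Q"
    and strip: "\<And>x y. (x, y) \<in> M \<Longrightarrow>
      (x, y) = (R, C + h) \<or> (x, y) = (R + k, C) \<or> k \<le> y - x \<and> y - x < int n"
  proof (cases "h = k")
    case True
    \<comment> \<open>For even \<open>n\<close> one square suffices: its bottom and top corners have
      offset \<open>i + k < n\<close>.\<close>
    let ?M = "{(R, C), (R, C + k), (R + k, C), (R + k, C + k)}"
    show ?thesis
    proof (rule that)
      show "triangulation R C k h ?M {#(R, C, k), (R + k, C + k, - k)#}"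
        using triangulation_square[of k R C] h(3) True by simp
      show "(x, y) = (R, C + h) \<or> (x, y) = (R + k, C) \<or> k \<le> y - x \<and> y - x < int n"
        if "(x, y) \<in> ?M" for x y
        using that True h(4) i by (auto simp: R_def C_def)
    qed
  next
    case False
    then have hk: "h = k + 1"
      using h(1) by simp
    \<comment> \<open>For odd \<open>n\<close>, taking \<open>p = i\<close> and
      \<open>q = k - i - 1\<close> gives the sides \<open>k\<close> and \<open>k + 1\<close>, and
      the bounds on \<open>y - x\<close> become \<open>k\<close> and
      \<open>2 * k = n - 1\<close>.\<close>
    obtain M Q where M: "triangulation R C (i + (k - i - 1) + 1) (i + (k - i - 1) + 2) M Q"
      and strip: "\<forall>(x, y) \<in> M. (x, y) = (R, C + i + (k - i - 1) + 2) \<or>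
        (x, y) = (R + i + (k - i - 1) + 1, C) \<or>
        C - R - i \<le> y - x \<and> y - x \<le> C - R + (k - i - 1) + 1"
      using triangulation_strip[of i "k - i - 1" R C] i by auto
    show ?thesis
    proof (rule that)
      show "triangulation R C k h M Q"
        using M hk by (simp add: add.commute)
      show "(x, y) = (R, C + h) \<or> (x, y) = (R + k, C) \<or> k \<le> y - x \<and> y - x < int n"
        if "(x, y) \<in> M" for x y
        using bspec[OF strip that] hk h(4) by (auto simp: R_def C_def)
    qed
  qed
  define g where "g = (\<lambda>(x, y). residue_triple n x y (x + y))"
  have trade: "latin_trade n (addition_table n) (g ` M)"
    unfolding g_def using triangulation_trade[OF tri] h by simp
  have "g (R, C + h) = (r, c, s)"
  proof -
    have "[C + h = int c] (mod int n)"
    proof -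
      have "C + h = int r + (int c - int r) mod int n + int n"
        using h(4) by (simp add: C_def i_def offset_def)
      then show ?thesis
        by (simp add: cong_def mod_add_right_eq)
    qed
    moreover from this have "[R + (C + h) = int (r + c)] (mod int n)"
      using cong_add[OF cong_refl, of "C + h" "int c" "int n" R] by (simp add: R_def)
    moreover have "nat (int m mod int n) = m mod n" for m
      by (metis nat_int zmod_int)
    ultimately show ?thesis
      using e' by (simp add: g_def residue_triple_def cong_def R_def del: of_nat_add)
  qed
  moreover have "diagonal_union n \<inter> g ` M \<subseteq> {g (R, C + h), g (R + k, C)}"
  proof
    fix t assume t: "t \<in> diagonal_union n \<inter> g ` M"
    then obtain x y where xy: "(x, y) \<in> M" "t = g (x, y)"
      by auto
    have "\<not> (k \<le> y - x \<and> y - x < int n)"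
    proof
      assume yx: "k \<le> y - x \<and> y - x < int n"
      have "offset n (nat (x mod int n)) (nat (y mod int n)) = (y - x) mod int n"
        using pos by (simp add: offset_def mod_diff_eq)
      also have "\<dots> = y - x"
        using yx h by simp
      finally show False
        using t yx xy by (simp add: mem_diagonal_union[OF pos] g_def residue_triple_def k_def)
    qed
    then show "t \<in> {g (R, C + h), g (R + k, C)}"
      using strip[OF xy(1)] xy(2) by auto
  qed
  ultimately show ?thesis
    using trade by (intro exI[of _ "g ` M"] exI[of _ "g (R + k, C)"]) simp
qed

theorem theorem5:
  fixes n :: nat
  assumes "n \<ge> 2"
  shows "minimally_strong_defining_set 2 n (addition_table n) (diagonal_union n)"
proof -
  let ?B = "addition_table n" and ?P = "diagonal_union n"
  have pos: "n > 0"
    using assms by simp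
  have two: "card (?P \<inter> T) \<ge> 2" if "latin_trade n ?B T" for T
    using trade_card_ge_two[OF pos that] .
  have "?P \<subseteq> ?B"
    using mem_diagonal_union[OF pos] by (auto simp: subset_iff)
  \<comment> \<open>Any other completion \<open>L\<close> would leave the trade
    \<open>?B - L\<close>, which misses the strip.\<close>
  moreover have "L = ?B" if L: "latin_square n L" "?P \<subseteq> L" for L
  proof (rule ccontr)
    assume "L \<noteq> ?B"
    then have "card (?P \<inter> (?B - L)) \<ge> 2"
      using two latin_square_diff_trade[OF latin_square_addition_table L(1)] by simp
    moreover have "?P \<inter> (?B - L) = {}"
      using L(2) by blast
    ultimately show False
      by simp
  qed
  ultimately have "strong_defining_set 2 n ?B ?P"
    using two latin_square_addition_table unfolding strong_defining_set_def defining_set_def by blast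
  moreover have "\<not> strong_defining_set 2 n ?B D" if "D \<subset> ?P" for D
  proof
    assume D: "strong_defining_set 2 n ?B D"
    obtain r c s where e: "(r, c, s) \<in> ?P" "(r, c, s) \<notin> D"
      using \<open>D \<subset> ?P\<close> by auto
    obtain T f where T: "latin_trade n ?B T" "?P \<inter> T \<subseteq> {(r, c, s), f}"
      using trade_through_entry[OF assms e(1)] by blast
    have "D \<inter> T \<subseteq> {f}"
      using T(2) e(2) \<open>D \<subset> ?P\<close> by auto
    then have "card (D \<inter> T) \<le> 1"
      using card_mono[of "{f}" "D \<inter> T"] by simp
    then show False
      using D T(1) unfolding strong_defining_set_def by fastforce
  qed
  ultimately show ?thesis
    by (simp add: minimally_strong_defining_set_def)
qed

end
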